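(* Let $\alpha \in (0,1)$ and $\beta > \alpha$. Suppose that there exist $c >0$, $C<\infty$, and $x_0 < \infty$ for which, for all $t \in \mathbb{Z}^+$, $$\mathbb{E} [ (\Delta_t^-)^\beta \mid \mathcal{F}_t ] \leq C \quad \text{a.s.},$$ and, for all $x \geq x_0$ and all $t \in \mathbb{Z}^+$, $$\mathbb{E} [ \Delta_t^+ \mathbf{1} \{ \Delta_t^+ \leq x \} \mid \mathcal{F}_t ] \geq c x^{1-\alpha} \quad \text{a.s.}$$ Then for any $x \in \mathbb{R}$ and any $p \in [0, (\beta/\alpha) -1 )$, $\mathbb{E} [ \lambda_x^{p} ] < \infty$.
   Context: $\mathbb{Z}^+ = \{0,1,2,\ldots\}$. $(X_t)_{t \in \mathbb{Z}^+}$ is a real-valued stochastic process adapted to a filtration $(\mathcal{F}_t)_{t \in \mathbb{Z}^+}$, with $X_0 = 0$ (no Markov property is assumed). Its increments are $\Delta_t := X_{t+1} - X_t$. For real $x$, $x^+ := x \mathbf{1}\{x>0\}$ and $x^- := -x\mathbf{1}\{x<0\}$; $\Delta_t^\pm := (\Delta_t)^\pm$. For $x \in \mathbb{R}$, $\lambda_x := \max \{ t \in \mathbb{Z}^+ : X_t \leq x \}$ is the last exit time from $(-\infty,x]$, with $\lambda_x = \infty$ if $X_t \leq x$ for infinitely many $t$, and $\lambda_x = 0$ if $X_t > x$ for all $t$. The constants $c, C, x_0$ are non-random and do not depend on $t$; $x_0$ is understood to be positive so that powers of $x \geq x_0$ are defined. *)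

theory Defs
  imports "HOL-Probability.Probability" "HOL-Probability.Stopping_Time"
begin

definition pos_part :: "real \<Rightarrow> real" where
  "pos_part x = x * indicator {0<..} x"

definition neg_part :: "real \<Rightarrow> real" where
  "neg_part x = - x * indicator {..<0} x"

definition increment :: "(nat \<Rightarrow> 'a \<Rightarrow> real) \<Rightarrow> nat \<Rightarrow> 'a \<Rightarrow> real" where
  "increment X t \<omega> = X (t + 1) \<omega> - X t \<omega>"

definition last_exit :: "(nat \<Rightarrow> 'a \<Rightarrow> real) \<Rightarrow> real \<Rightarrow> 'a \<Rightarrow> enat" where
  "last_exit X x \<omega> =
    (if infinite {t. X t \<omega> \<le> x} then \<infinity>
     else if {t. X t \<omega> \<le> x} = {} then 0
     else enat (Max {t. X t \<omega> \<le> x}))"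

(* Only meant for p >= 0. The case p = 0 is separate because 0 powr 0 = 0 in the library,
   whereas here every value, including 0 and \<infinity>, has power 1 for p = 0.
   For p > 0, the power of \<infinity> is \<infinity>. *)
definition enat_powr :: "enat \<Rightarrow> real \<Rightarrow> ennreal" where
  "enat_powr n p =
    (if p = 0 then 1
     else case n of enat k \<Rightarrow> ennreal (real k powr p) | \<infinity> \<Rightarrow> \<infinity>)"

end

theory Submission
  imports Defs "HOL-Real_Asymp.Real_Asymp"
begin

text \<open>
  Fix a level \<open>y\<close> and erase every increment of absolute value above \<open>y\<close>.  Erasing upward jumps only
  lowers the walk.  Erasing downward jumps raises it only if one occurs, and by Markov's
  inequality such a jump occurs among the first \<open>2 n\<close> with probability at most
  \<open>2 n C y powr (- \<beta>)\<close>.  The erased walk has conditional drift at least of order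
  \<open>y powr (1 - \<alpha>)\<close>: the downward part contributes at most of order \<open>y powr (1 - min 1 \<beta>)\<close>, which is
  smaller because \<open>\<alpha> < min 1 \<beta>\<close>.  Its steps are bounded by \<open>y\<close>, so the exponential of minus the
  erased walk divided by \<open>2 y\<close> contracts in mean, at each step, by a factor
  \<open>exp (- \<kappa> * y powr (- \<alpha>))\<close>, where \<open>\<kappa> = c / 8\<close> (\<open>exp_truncation_step\<close>, \<open>nn_integral_damping_le\<close>).
  The drift of the
  erased walk may be arbitrarily large compared with \<open>y powr (1 - \<alpha>)\<close>, but this does no harm to a
  lower deviation estimate: the second-order term of a positive step of size at most \<open>y\<close> is
  absorbed by its own first-order term.

  Hence the probability that the walk is at or below \<open>x\<close> at some time in \<open>{n..<2 * n}\<close> is at most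
  of order \<open>n y powr (- \<beta>) + n exp (- \<kappa> n y powr (- \<alpha>))\<close> (\<open>emeasure_low_in_block_le\<close>).  Taking
  \<open>y = n powr \<delta>\<close> with \<open>\<delta>\<close> slightly below \<open>1 / \<alpha>\<close> makes the second term smaller than any power of
  \<open>n\<close>, while the first is nearly \<open>n powr (1 - \<beta> / \<alpha>)\<close>.  Since \<open>p < \<beta> / \<alpha> - 1\<close>, these
  probabilities, weighted with \<open>(2 n) powr p\<close>, are summable over \<open>n = 2 ^ k\<close>
  (\<open>summable_dyadic_blocks\<close>), and the weighted sum of the
  events dominates the \<open>p\<close>-th power of the last exit time (\<open>last_exit_powr_le\<close>).
\<close>

section \<open>Exponential estimate for one truncated increment\<close>

definition truncation :: "real \<Rightarrow> real \<Rightarrow> real" where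
  "truncation y z = z * indicator {-y..y} z"

lemma truncation_measurable [measurable]: "truncation y \<in> borel_measurable borel"
  unfolding truncation_def by measurable

lemma pos_part_measurable [measurable]: "pos_part \<in> borel_measurable borel"
  unfolding pos_part_def by measurable

lemma neg_part_measurable [measurable]: "neg_part \<in> borel_measurable borel"
  unfolding neg_part_def by measurable

lemma pos_part_nonneg: "0 \<le> pos_part z"
  by (simp add: pos_part_def indicator_def)

lemma truncation_le: "0 \<le> y \<Longrightarrow> -y \<le> z \<Longrightarrow> truncation y z \<le> z"
  by (simp add: truncation_def indicator_def)

text \<open>
  For a positive step, \<open>exp (- u) \<le> 1 - u / 2\<close> on the unit interval already absorbs the quadratic
  term, so half of the first-order gain survives whatever the distribution of the step.  For a
  negative step of size \<open>n \<le> y\<close> the loss is at most \<open>n / y\<close>; as this ratio is at most 1, it may be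
  raised to the power \<open>min 1 \<beta>\<close>, which brings it within reach of the moment of order \<open>\<beta>\<close> both
  when that moment controls the mean and when it does not.
\<close>

lemma exp_truncation_le:
  fixes y z \<beta> :: real
  assumes y: "1 \<le> y" and \<beta>: "0 < \<beta>"
  shows "exp (- truncation y z / (2 * y))
           + pos_part z * indicator {..y} (pos_part z) / (4 * y)
         \<le> 1 + y powr (- min 1 \<beta>) * (1 + neg_part z powr \<beta>)"
proof -
  have nn: "0 \<le> y powr (- min 1 \<beta>) * (1 + neg_part z powr \<beta>)"
    by (intro mult_nonneg_nonneg add_nonneg_nonneg) auto
  consider "z > y" | "0 \<le> z" "z \<le> y" | "z < 0" "- y \<le> z" | "z < - y"
    using y by linarith
  then show ?thesis
  proof cases
    case 1
    then have "truncation y z = 0" "indicator {..y} (pos_part z) = (0::real)"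
      using y by (auto simp: truncation_def pos_part_def indicator_def)
    then show ?thesis using nn by simp
  next
    case 2
    define u where "u = z / (2 * y)"
    have u: "0 \<le> u" "u \<le> 1"
      using 2 y by (auto simp: u_def field_simps)
    have "exp (-u) \<le> inverse (1 + u)"
      using u exp_ge_add_one_self[of u] by (simp add: exp_minus le_imp_inverse_le)
    also have "\<dots> \<le> 1 - u / 2"
    proof -
      have "0 \<le> u * (1 - u)" using u by simp
      then have "1 \<le> (1 - u / 2) * (1 + u)" by (simp add: field_simps)
      then show ?thesis using u by (simp add: inverse_eq_divide pos_divide_le_eq)
    qed
    finally have "exp (-u) + u / 2 \<le> 1" by simp
    moreover have "truncation y z = z" "pos_part z * indicator {..y} (pos_part z) = z"
      using 2 y by (auto simp: truncation_def pos_part_def indicator_def)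
    ultimately show ?thesis using nn by (simp add: u_def, linarith)
  next
    case 3
    define n b where "n = - z" and "b = min 1 \<beta>"
    have n: "0 < n" "n \<le> y" using 3 by (auto simp: n_def)
    have b: "0 < b" "b \<le> 1" "b \<le> \<beta>" using \<beta> by (auto simp: b_def)
    define v where "v = n / (2 * y)"
    have v: "0 \<le> v" "v \<le> 1" using n y by (auto simp: v_def field_simps)
    have "exp v \<le> 1 + v + v\<^sup>2" by (rule exp_bound) (use v in auto)
    also have "v\<^sup>2 \<le> v" using v by (simp add: power2_eq_square mult_left_le)
    finally have "exp v \<le> 1 + n / y" using y by (simp add: v_def field_simps)
    also have "n / y \<le> (n / y) powr b"
      using powr_mono'[of b 1 "n / y"] n y b by simp
    also have "\<dots> = y powr (- b) * n powr b"
      using n y by (simp add: powr_divide powr_minus_divide)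
    also have "n powr b \<le> 1 + n powr \<beta>"
    proof (cases "n \<le> 1")
      case True
      then have "n powr b \<le> 1" using n b by (intro powr_le1) auto
      then show ?thesis using powr_ge_zero[of n \<beta>] by linarith
    next
      case False
      then have "n powr b \<le> n powr \<beta>" using b by (intro powr_mono) auto
      then show ?thesis by simp
    qed
    finally have "exp v \<le> 1 + y powr - b * (1 + n powr \<beta>)"
      by (simp add: mult_left_mono)
    moreover have "truncation y z = z" "pos_part z = 0" "neg_part z = n"
      using 3 y by (auto simp: truncation_def pos_part_def neg_part_def indicator_def n_def)
    ultimately show ?thesis by (simp add: v_def b_def n_def)
  next
    case 4
    then have "truncation y z = 0" "pos_part z = 0"
      using y by (auto simp: truncation_def pos_part_def indicator_def)
    then show ?thesis using nn by simp
  qed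
qed

text \<open>
  The pointwise estimate is integrated against a weight \<open>W\<close> known at the present time.  All terms
  are kept nonnegative, with the gain on the left-hand side, so that nonnegative conditional
  expectations suffice; finiteness of the mean of \<open>W\<close> permits the subtraction at the end.
\<close>

lemma (in sigma_finite_subalgebra) exp_truncation_step:
  fixes W D :: "'a \<Rightarrow> real" and y \<alpha> \<beta> c K w :: real
  assumes W [measurable]: "W \<in> borel_measurable F" and W0: "\<And>\<omega>. 0 \<le> W \<omega>"
    and w: "(\<integral>\<^sup>+ \<omega>. ennreal (W \<omega>) \<partial>M) = ennreal w" "0 \<le> w"
    and D [measurable]: "D \<in> borel_measurable M"
    and y: "1 \<le> y" and \<beta>: "0 < \<beta>" and K: "0 \<le> K" and c: "0 \<le> c"
    and neg: "AE \<omega> in M. nn_cond_exp M F (\<lambda>\<omega>. ennreal (neg_part (D \<omega>) powr \<beta>)) \<omega> \<le> ennreal K"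
    and pos: "AE \<omega> in M. ennreal (c * y powr (1 - \<alpha>))
       \<le> nn_cond_exp M F
            (\<lambda>\<omega>. ennreal (pos_part (D \<omega>) * indicator {..y} (pos_part (D \<omega>)))) \<omega>"
  shows "(\<integral>\<^sup>+ \<omega>. ennreal (W \<omega> * exp (- truncation y (D \<omega>) / (2 * y))) \<partial>M)
    \<le> ennreal ((1 + y powr (- min 1 \<beta>) * (1 + K) - c / 4 * y powr (- \<alpha>)) * w)"
proof -
  define P where "P = (\<lambda>\<omega>. pos_part (D \<omega>) * indicator {..y} (pos_part (D \<omega>)) :: real)"
  define N where "N = (\<lambda>\<omega>. neg_part (D \<omega>) powr \<beta>)"
  define r where "r = y powr (- min 1 \<beta>)"
  let ?Z = "\<lambda>\<omega>. exp (- truncation y (D \<omega>) / (2 * y))"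
  have [measurable]: "P \<in> borel_measurable M" "N \<in> borel_measurable M"
    unfolding P_def N_def by measurable
  have WM [measurable]: "W \<in> borel_measurable M"
    using W subalg measurable_from_subalg by blast
  have P0: "0 \<le> P \<omega>" for \<omega> by (simp add: P_def pos_part_nonneg)
  have N0: "0 \<le> N \<omega>" for \<omega> by (simp add: N_def)
  have r0: "0 \<le> r" by (simp add: r_def)
  have intN: "(\<integral>\<^sup>+ \<omega>. ennreal (W \<omega>) * ennreal (N \<omega>) \<partial>M) \<le> ennreal (K * w)"
  proof -
    have "(\<integral>\<^sup>+ \<omega>. ennreal (W \<omega>) * ennreal (N \<omega>) \<partial>M)
        = (\<integral>\<^sup>+ \<omega>. ennreal (W \<omega>) * nn_cond_exp M F (\<lambda>\<omega>. ennreal (N \<omega>)) \<omega> \<partial>M)"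
      by (rule nn_cond_exp_intg[symmetric]) measurable
    also have "\<dots> \<le> (\<integral>\<^sup>+ \<omega>. ennreal (W \<omega>) * ennreal K \<partial>M)"
      using neg by (intro nn_integral_mono_AE) (auto simp: N_def elim!: eventually_mono intro!: mult_left_mono)
    also have "\<dots> = ennreal (K * w)"
      using w K by (simp add: nn_integral_multc nn_integral_cmult ennreal_mult mult.commute)
    finally show ?thesis .
  qed
  have intP: "ennreal (c * y powr (1 - \<alpha>) * w) \<le> (\<integral>\<^sup>+ \<omega>. ennreal (W \<omega>) * ennreal (P \<omega>) \<partial>M)"
  proof -
    have "ennreal (c * y powr (1 - \<alpha>) * w) = (\<integral>\<^sup>+ \<omega>. ennreal (W \<omega>) * ennreal (c * y powr (1 - \<alpha>)) \<partial>M)"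
      using w c by (simp add: nn_integral_multc nn_integral_cmult ennreal_mult mult.commute)
    also have "\<dots> \<le> (\<integral>\<^sup>+ \<omega>. ennreal (W \<omega>) * nn_cond_exp M F (\<lambda>\<omega>. ennreal (P \<omega>)) \<omega> \<partial>M)"
      using pos by (intro nn_integral_mono_AE) (auto simp: P_def elim!: eventually_mono intro!: mult_left_mono)
    also have "\<dots> = (\<integral>\<^sup>+ \<omega>. ennreal (W \<omega>) * ennreal (P \<omega>) \<partial>M)"
      by (rule nn_cond_exp_intg) measurable
    finally show ?thesis .
  qed
  have "(\<integral>\<^sup>+ \<omega>. ennreal (W \<omega> * ?Z \<omega>) \<partial>M) + ennreal (1 / (4 * y)) * ennreal (c * y powr (1 - \<alpha>) * w)
    \<le> (\<integral>\<^sup>+ \<omega>. ennreal (W \<omega> * ?Z \<omega>) \<partial>M)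
        + ennreal (1 / (4 * y)) * (\<integral>\<^sup>+ \<omega>. ennreal (W \<omega>) * ennreal (P \<omega>) \<partial>M)"
    by (intro add_left_mono mult_left_mono intP) auto
  also have "\<dots> = (\<integral>\<^sup>+ \<omega>. ennreal (W \<omega> * (?Z \<omega> + P \<omega> / (4 * y))) \<partial>M)"
  proof -
    have "ennreal (W \<omega> * (?Z \<omega> + P \<omega> / (4 * y)))
      = ennreal (W \<omega> * ?Z \<omega>) + ennreal (1 / (4 * y)) * (ennreal (W \<omega>) * ennreal (P \<omega>))" for \<omega>
      using W0[of \<omega>] P0[of \<omega>] y
      by (simp add: ennreal_mult[symmetric] ennreal_plus[symmetric] field_simps del: ennreal_plus)
    then show ?thesis
      by (simp add: nn_integral_add nn_integral_cmult)
  qed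
  also have "\<dots> \<le> (\<integral>\<^sup>+ \<omega>. ennreal (1 + r) * ennreal (W \<omega>)
      + ennreal r * (ennreal (W \<omega>) * ennreal (N \<omega>)) \<partial>M)"
  proof (rule nn_integral_mono)
    fix \<omega>
    have "W \<omega> * (?Z \<omega> + P \<omega> / (4 * y)) \<le> W \<omega> * (1 + r * (1 + N \<omega>))"
      using exp_truncation_le[OF y \<beta>, of "D \<omega>"] W0[of \<omega>]
      by (intro mult_left_mono) (auto simp: P_def N_def r_def)
    also have "\<dots> = (1 + r) * W \<omega> + r * (W \<omega> * N \<omega>)" by (simp add: algebra_simps)
    finally have "ennreal (W \<omega> * (?Z \<omega> + P \<omega> / (4 * y))) \<le> ennreal ((1 + r) * W \<omega> + r * (W \<omega> * N \<omega>))"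
      by (rule ennreal_leI)
    also have "\<dots> = ennreal (1 + r) * ennreal (W \<omega>) + ennreal r * (ennreal (W \<omega>) * ennreal (N \<omega>))"
      using W0[of \<omega>] N0[of \<omega>] r0 
      by (simp add: ennreal_mult[symmetric] ennreal_plus[symmetric] del: ennreal_plus)
    finally show "ennreal (W \<omega> * (?Z \<omega> + P \<omega> / (4 * y)))
      \<le> ennreal (1 + r) * ennreal (W \<omega>) + ennreal r * (ennreal (W \<omega>) * ennreal (N \<omega>))" .
  qed
  also have "\<dots> = ennreal (1 + r) * ennreal w + ennreal r * (\<integral>\<^sup>+ \<omega>. ennreal (W \<omega>) * ennreal (N \<omega>) \<partial>M)"
    using w by (simp add: nn_integral_add nn_integral_cmult)
  also have "\<dots> \<le> ennreal (1 + r) * ennreal w + ennreal r * ennreal (K * w)"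
    by (intro add_left_mono mult_left_mono intN) auto
  also have "\<dots> = ennreal ((1 + r * (1 + K)) * w)"
    using w K r0 
    by (simp add: ennreal_mult[symmetric] ennreal_plus[symmetric] algebra_simps del: ennreal_plus)
  finally have main: "(\<integral>\<^sup>+ \<omega>. ennreal (W \<omega> * ?Z \<omega>) \<partial>M)
      + ennreal (1 / (4 * y)) * ennreal (c * y powr (1 - \<alpha>) * w) \<le> ennreal ((1 + r * (1 + K)) * w)" .
  have q: "ennreal (1 / (4 * y)) * ennreal (c * y powr (1 - \<alpha>) * w) = ennreal (c / 4 * y powr (- \<alpha>) * w)"
  proof -
    have "y powr (1 - \<alpha>) = y * y powr (- \<alpha>)" using y by (simp add: powr_diff powr_minus divide_inverse)
    then show ?thesis using y w c by (simp add: ennreal_mult[symmetric])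
  qed
  have q0: "0 \<le> c / 4 * y powr (- \<alpha>) * w" using c w by simp
  have "(\<integral>\<^sup>+ \<omega>. ennreal (W \<omega> * ?Z \<omega>) \<partial>M)
      \<le> ennreal ((1 + r * (1 + K)) * w - c / 4 * y powr (- \<alpha>) * w)"
    using main q0 unfolding q
    by (cases "\<integral>\<^sup>+ \<omega>. ennreal (W \<omega> * ?Z \<omega>) \<partial>M")
       (auto simp: ennreal_plus[symmetric] ennreal_le_iff2 top_unique simp del: ennreal_plus)
  then show ?thesis by (simp add: r_def algebra_simps)
qed

section \<open>Probability of being low during a block of times\<close>

locale strong_positive_drift = prob_space M + filtration "space M" F
  for M :: "'a measure" and F :: "nat \<Rightarrow> 'a measure" +
  fixes X :: "nat \<Rightarrow> 'a \<Rightarrow> real" and \<alpha> \<beta> c x0 K :: real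
  assumes subalg: "\<And>t. subalgebra M (F t)"
    and adapted: "\<And>t. X t \<in> borel_measurable (F t)"
    and start: "\<And>\<omega>. \<omega> \<in> space M \<Longrightarrow> X 0 \<omega> = 0"
    and \<alpha>_pos: "0 < \<alpha>" and \<alpha>_less_1: "\<alpha> < 1" and \<alpha>_less_\<beta>: "\<alpha> < \<beta>"
    and c_pos: "0 < c" and K_nonneg: "0 \<le> K"
    and neg_moment: "\<And>t. AE \<omega> in M.
           nn_cond_exp M (F t) (\<lambda>\<omega>. ennreal (neg_part (increment X t \<omega>) powr \<beta>)) \<omega> \<le> ennreal K"
    and pos_drift: "\<And>y t. x0 \<le> y \<Longrightarrow> AE \<omega> in M.
           ennreal (c * y powr (1 - \<alpha>))
             \<le> nn_cond_exp M (F t)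
                  (\<lambda>\<omega>. ennreal (pos_part (increment X t \<omega>)
                                 * indicator {..y} (pos_part (increment X t \<omega>)))) \<omega>"
begin

lemma X_measurable [measurable]: "X t \<in> borel_measurable M"
  using adapted subalg measurable_from_subalg by blast

lemma X_measurable_later: "s \<le> t \<Longrightarrow> X s \<in> borel_measurable (F t)"
  using adapted[of s] sets_F_mono[of s t] space_F
  by (auto simp: measurable_def)

lemma increment_measurable [measurable]: "increment X t \<in> borel_measurable M"
  unfolding increment_def by measurable

lemma sigma_finite_F: "sigma_finite_subalgebra M (F t)"
  by (intro finite_measure_subalgebra_is_sigma_finite finite_measure_subalgebra.intro
        finite_measure_axioms finite_measure_subalgebra_axioms.intro subalg)

text \<open>
  The exponential of minus the truncated walk divided by \<open>2 y\<close>, written as a product so that one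
  more step is one more factor.
\<close>

definition damping :: "real \<Rightarrow> nat \<Rightarrow> 'a \<Rightarrow> real" where
  "damping y t \<omega> = (\<Prod>s<t. exp (- truncation y (increment X s \<omega>) / (2 * y)))"

lemma damping_pos: "0 < damping y t \<omega>"
  by (simp add: damping_def prod_pos)

lemma damping_adapted: "damping y t \<in> borel_measurable (F t)"
proof -
  have "(\<lambda>\<omega>. exp (- truncation y (increment X s \<omega>) / (2 * y))) \<in> borel_measurable (F t)"
    if "s < t" for s
  proof -
    have [measurable]: "X s \<in> borel_measurable (F t)" "X (s + 1) \<in> borel_measurable (F t)"
      using that by (auto intro!: X_measurable_later)
    show ?thesis unfolding increment_def by measurable
  qed
  then show ?thesis unfolding damping_def by (intro borel_measurable_prod) auto
qed

lemma damping_measurable [measurable]: "damping y t \<in> borel_measurable M"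
  using damping_adapted subalg measurable_from_subalg by blast

text \<open>
  The last assumption, valid for all large \<open>y\<close>, says that the loss from negative steps takes up at
  most half of the gain \<open>c / 4 * y powr (- \<alpha>)\<close> from positive ones.
\<close>

lemma nn_integral_damping_le:
  assumes y: "1 \<le> y" "x0 \<le> y"
    and dominated: "y powr (- min 1 \<beta>) * (1 + K) \<le> c / 8 * y powr (- \<alpha>)"
  shows "(\<integral>\<^sup>+ \<omega>. ennreal (damping y t \<omega>) \<partial>M) \<le> ennreal (exp (- (c / 8 * y powr (- \<alpha>) * real t)))"
proof (induction t)
  case 0
  then show ?case by (simp add: damping_def emeasure_space_1)
next
  case (Suc t)
  let ?I = "\<lambda>t. (\<integral>\<^sup>+ \<omega>. ennreal (damping y t \<omega>) \<partial>M)"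
  define \<kappa> where "\<kappa> = c / 8 * y powr (- \<alpha>)"
  interpret sigma_finite_subalgebra M "F t" by (rule sigma_finite_F)
  have "?I t < \<top>" using Suc.IH by (rule order.strict_trans1) simp
  then obtain w where w: "?I t = ennreal w" "0 \<le> w" by (cases "?I t") auto
  have le: "w \<le> exp (- (\<kappa> * t))"
    using Suc.IH w by (simp add: \<kappa>_def)
  have "?I (Suc t) = (\<integral>\<^sup>+ \<omega>. ennreal (damping y t \<omega>
      * exp (- truncation y (increment X t \<omega>) / (2 * y))) \<partial>M)"
    by (simp add: damping_def)
  also have "\<dots> \<le> ennreal ((1 + y powr (- min 1 \<beta>) * (1 + K) - c / 4 * y powr (- \<alpha>)) * w)"
    using damping_adapted damping_pos w y K_nonneg c_pos neg_moment pos_drift \<alpha>_pos \<alpha>_less_\<beta>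
    by (intro exp_truncation_step) (auto intro: less_imp_le)
  also have "\<dots> \<le> ennreal (exp (- \<kappa>) * exp (- (\<kappa> * t)))"
  proof (intro ennreal_leI mult_mono le)
    have "1 + y powr (- min 1 \<beta>) * (1 + K) - c / 4 * y powr (- \<alpha>) \<le> 1 - \<kappa>"
      using dominated by (simp add: \<kappa>_def)
    also have "\<dots> \<le> exp (- \<kappa>)" using exp_ge_add_one_self[of "- \<kappa>"] by simp
    finally show "1 + y powr (- min 1 \<beta>) * (1 + K) - c / 4 * y powr (- \<alpha>) \<le> exp (- \<kappa>)" .
  qed (use w in auto)
  also have "exp (- \<kappa>) * exp (- (\<kappa> * t)) = exp (- (\<kappa> * Suc t))"
    by (simp add: exp_add[symmetric] algebra_simps)
  finally show ?case by (simp add: \<kappa>_def)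
qed

lemma nn_integral_neg_part_le:
  "(\<integral>\<^sup>+ \<omega>. ennreal (neg_part (increment X t \<omega>) powr \<beta>) \<partial>M) \<le> ennreal K"
proof -
  interpret sigma_finite_subalgebra M "F t" by (rule sigma_finite_F)
  have "(\<integral>\<^sup>+ \<omega>. 1 * ennreal (neg_part (increment X t \<omega>) powr \<beta>) \<partial>M)
    = (\<integral>\<^sup>+ \<omega>. 1 * nn_cond_exp M (F t) (\<lambda>\<omega>. ennreal (neg_part (increment X t \<omega>) powr \<beta>)) \<omega> \<partial>M)"
    by (rule nn_cond_exp_intg[symmetric]) measurable
  also have "\<dots> \<le> (\<integral>\<^sup>+ \<omega>. ennreal K \<partial>M)"
    using neg_moment[of t] by (intro nn_integral_mono_AE) auto
  finally show ?thesis by (simp add: emeasure_space_1)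
qed

text \<open>
  Without a drop larger than \<open>y\<close>, truncation can only lower the walk, so a low walk forces a low
  truncated walk and hence a large damping factor.
\<close>

lemma damping_ge_of_no_large_drop:
  assumes \<omega>: "\<omega> \<in> space M" and y: "1 \<le> y"
    and no_drop: "\<And>s. s < t \<Longrightarrow> - y \<le> increment X s \<omega>"
    and low: "X t \<omega> \<le> x"
  shows "1 \<le> exp \<bar>x\<bar> * damping y t \<omega>"
proof -
  have "(\<Sum>s<t. truncation y (increment X s \<omega>)) \<le> (\<Sum>s<t. increment X s \<omega>)"
    using y no_drop by (intro sum_mono truncation_le) auto
  also have "\<dots> = X t \<omega>"
    using start[OF \<omega>] sum_lessThan_telescope[of "\<lambda>s. X s \<omega>" t] by (simp add: increment_def)
  finally have S: "(\<Sum>s<t. truncation y (increment X s \<omega>)) \<le> \<bar>x\<bar>" using low by linarith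
  have "(\<Sum>s<t. truncation y (increment X s \<omega>)) / (2 * y) \<le> \<bar>x\<bar>"
  proof -
    have "\<bar>x\<bar> * 1 \<le> \<bar>x\<bar> * (2 * y)" using y by (intro mult_left_mono) auto
    then show ?thesis using S y by (simp add: pos_divide_le_eq)
  qed
  moreover have "damping y t \<omega> = exp (- ((\<Sum>s<t. truncation y (increment X s \<omega>)) / (2 * y)))"
    by (simp add: damping_def exp_sum[symmetric] sum_negf sum_divide_distrib)
  ultimately show ?thesis by (simp add: exp_add[symmetric])
qed

text \<open>
  On the event, either some drop before time \<open>2 n\<close> exceeds \<open>y\<close>, or the damping factor is bounded
  below at a time in the block.  Both alternatives are charged at once: the indicator of the event
  is dominated by a sum whose terms have small means.
\<close>

lemma emeasure_low_in_block_le: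
  assumes y: "1 \<le> y" "x0 \<le> y"
    and dominated: "y powr (- min 1 \<beta>) * (1 + K) \<le> c / 8 * y powr (- \<alpha>)"
  shows "emeasure M {\<omega> \<in> space M. \<exists>t\<in>{n..<2 * n}. X t \<omega> \<le> x}
    \<le> ennreal (2 * real n * K * y powr (- \<beta>)
         + real n * exp \<bar>x\<bar> * exp (- (c / 8 * y powr (- \<alpha>) * real n)))"
proof -
  let ?A = "{\<omega> \<in> space M. \<exists>t\<in>{n..<2 * n}. X t \<omega> \<le> x}"
  let ?N = "\<lambda>s \<omega>. neg_part (increment X s \<omega>) powr \<beta>"
  let ?e = "exp (- (c / 8 * y powr (- \<alpha>) * real n))"
  have "emeasure M ?A = (\<integral>\<^sup>+ \<omega>. indicator ?A \<omega> \<partial>M)" by simp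
  also have "\<dots> \<le> (\<integral>\<^sup>+ \<omega>. (\<Sum>s<2 * n. ennreal (y powr (- \<beta>)) * ennreal (?N s \<omega>))
       + (\<Sum>t\<in>{n..<2 * n}. ennreal (exp \<bar>x\<bar>) * ennreal (damping y t \<omega>)) \<partial>M)"
    (is "_ \<le> (\<integral>\<^sup>+ \<omega>. ?L \<omega> + ?R \<omega> \<partial>M)")
  proof (rule nn_integral_mono)
    fix \<omega> assume \<omega>: "\<omega> \<in> space M"
    show "indicator ?A \<omega> \<le> ?L \<omega> + ?R \<omega>"
    proof (cases "\<omega> \<in> ?A")
      case True
      then obtain t where t: "t \<in> {n..<2 * n}" "X t \<omega> \<le> x" by auto
      show ?thesis
      proof (cases "\<exists>s<2 * n. increment X s \<omega> < - y")
        case True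
        then obtain s where s: "s < 2 * n" "increment X s \<omega> < - y" by auto
        then have "y \<le> neg_part (increment X s \<omega>)" using y by (simp add: neg_part_def)
        then have "y powr \<beta> \<le> ?N s \<omega>"
          using y \<alpha>_pos \<alpha>_less_\<beta> by (intro powr_mono2) auto
        then have "y powr (- \<beta>) * y powr \<beta> \<le> y powr (- \<beta>) * ?N s \<omega>"
          by (intro mult_left_mono) auto
        then have "1 \<le> y powr (- \<beta>) * ?N s \<omega>" using y by (simp add: powr_add[symmetric])
        then have "1 \<le> ennreal (y powr (- \<beta>)) * ennreal (?N s \<omega>)"
          by (simp add: ennreal_mult[symmetric])
        also have "\<dots> \<le> ?L \<omega>" using s by (intro member_le_sum) auto
        also have "\<dots> \<le> ?L \<omega> + ?R \<omega>" by simp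
        finally show ?thesis by (rule order.trans[rotated]) (simp add: indicator_def)
      next
        case False
        then have "- y \<le> increment X s \<omega>" if "s < t" for s
          using that t by (meson atLeastLessThan_iff less_trans not_less)
        then have "1 \<le> exp \<bar>x\<bar> * damping y t \<omega>"
          using t y \<omega> by (intro damping_ge_of_no_large_drop) (auto simp: not_less)
        then have "1 \<le> ennreal (exp \<bar>x\<bar>) * ennreal (damping y t \<omega>)"
          using damping_pos[of y t \<omega>] by (simp add: ennreal_mult[symmetric] less_imp_le)
        also have "\<dots> \<le> ?R \<omega>" using t by (intro member_le_sum) auto
        also have "\<dots> \<le> ?L \<omega> + ?R \<omega>" by simp
        finally show ?thesis by (rule order.trans[rotated]) (simp add: indicator_def)
      qed
    qed auto
  qed
  also have "\<dots> = (\<Sum>s<2 * n. ennreal (y powr (- \<beta>)) * (\<integral>\<^sup>+ \<omega>. ennreal (?N s \<omega>) \<partial>M))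
     + (\<Sum>t\<in>{n..<2 * n}. ennreal (exp \<bar>x\<bar>) * (\<integral>\<^sup>+ \<omega>. ennreal (damping y t \<omega>) \<partial>M))"
    by (simp add: nn_integral_add nn_integral_sum nn_integral_cmult)
  also have "\<dots> \<le> (\<Sum>s<2 * n. ennreal (y powr (- \<beta>)) * ennreal K)
     + (\<Sum>t\<in>{n..<2 * n}. ennreal (exp \<bar>x\<bar>) * ennreal ?e)"
  proof (intro add_mono sum_mono mult_left_mono nn_integral_neg_part_le)
    fix t assume "t \<in> {n..<2 * n}"
    then have "c / 8 * y powr (- \<alpha>) * real n \<le> c / 8 * y powr (- \<alpha>) * real t"
      using c_pos by (intro mult_left_mono) auto
    then have "ennreal (exp (- (c / 8 * y powr (- \<alpha>) * real t))) \<le> ennreal ?e"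
      by (intro ennreal_leI) simp
    with nn_integral_damping_le[OF y dominated, of t]
    show "(\<integral>\<^sup>+ \<omega>. ennreal (damping y t \<omega>) \<partial>M) \<le> ennreal ?e" by (rule order.trans)
  qed auto
  also have "\<dots> = ennreal (2 * real n * K * y powr (- \<beta>) + real n * exp \<bar>x\<bar> * ?e)"
    using K_nonneg 
    by (simp add: ennreal_mult[symmetric] ennreal_plus[symmetric] ennreal_of_nat_eq_real_of_nat
          mult_ac del: ennreal_plus)
  finally show ?thesis .
qed

section \<open>Summation over dyadic blocks\<close>

text \<open>
  The truncation level is \<open>n powr \<delta>\<close>.  A large drop requires \<open>\<delta> * \<beta> > p + 1\<close> to be summable with the
  weight \<open>(2 n) powr p\<close>, and the exponential estimate requires \<open>\<delta> * \<alpha> < 1\<close>.  Such a \<open>\<delta>\<close> exists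
  exactly when \<open>p < \<beta> / \<alpha> - 1\<close>.
\<close>

lemma summable_dyadic_blocks:
  assumes p: "0 \<le> p" "p < \<beta> / \<alpha> - 1"
  shows "summable (\<lambda>k. (2 * 2 ^ k) powr p
           * prob {\<omega> \<in> space M. \<exists>t\<in>{2 ^ k..<2 * 2 ^ k}. X t \<omega> \<le> x})"
proof -
  have \<beta>_pos: "0 < \<beta>" using \<alpha>_pos \<alpha>_less_\<beta> by simp
  have "(p + 1) / \<beta> < 1 / \<alpha>" using p \<alpha>_pos \<beta>_pos by (simp add: field_simps)
  then obtain \<delta> where \<delta>: "(p + 1) / \<beta> < \<delta>" "\<delta> < 1 / \<alpha>" using dense by blast
  have \<delta>1: "p + 1 < \<delta> * \<beta>" and \<delta>2: "\<delta> * \<alpha> < 1"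
    using \<delta> \<alpha>_pos \<beta>_pos by (auto simp: field_simps)
  have \<delta>_pos: "0 < \<delta>" using \<delta>(1) p \<beta>_pos
    by (smt (verit) divide_nonneg_pos)
  \<comment> \<open>\<open>\<theta>\<close> is the decay exponent left in the weighted probabilities, and \<open>\<eta>\<close> is the exponent for
    which the exponential estimate becomes \<open>exp (- const * n powr \<eta>)\<close>.\<close>
  define \<theta> where "\<theta> = \<delta> * \<beta> - (p + 1)"
  define \<eta> where "\<eta> = 1 - \<delta> * \<alpha>"
  have \<theta>: "0 < \<theta>" and \<eta>: "0 < \<eta>" using \<delta>1 \<delta>2 by (auto simp: \<theta>_def \<eta>_def)
  define A where "A = (\<lambda>n::nat. {\<omega> \<in> space M. \<exists>t\<in>{n..<2 * n}. X t \<omega> \<le> x})"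
  define B where "B = 2 powr p * (2 * K + exp \<bar>x\<bar>)"
  have gap: "\<alpha> < min 1 \<beta>" using \<alpha>_less_1 \<alpha>_less_\<beta> by simp
  have ev_y: "eventually (\<lambda>y. 1 \<le> y \<and> x0 \<le> y \<and>
      y powr (- min 1 \<beta>) * (1 + K) \<le> c / 8 * y powr (- \<alpha>)) at_top"
  proof -
    have "((\<lambda>y::real. y powr (\<alpha> - min 1 \<beta>) * (1 + K)) \<longlongrightarrow> 0 * (1 + K)) at_top"
      using gap by (intro tendsto_mult_right tendsto_neg_powr filterlim_ident) auto
    then have "eventually (\<lambda>y::real. y powr (\<alpha> - min 1 \<beta>) * (1 + K) < c / 8) at_top"
      using c_pos by (intro order_tendstoD(2)) auto
    with eventually_ge_at_top[of 1] eventually_ge_at_top[of x0] show ?thesis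
    proof eventually_elim
      case (elim y)
      have "y powr (- min 1 \<beta>) * (1 + K) = y powr (- \<alpha>) * (y powr (\<alpha> - min 1 \<beta>) * (1 + K))"
        using elim by (simp add: powr_add[symmetric])
      also have "\<dots> \<le> y powr (- \<alpha>) * (c / 8)"
        using elim by (intro mult_left_mono) auto
      finally show ?case using elim by (simp add: mult_ac)
    qed
  qed
  have lim_n: "filterlim (\<lambda>n::nat. real n powr \<delta>) at_top sequentially"
    using \<delta>_pos by real_asymp
  have ev_exp: "eventually (\<lambda>n::nat. exp (- (c / 8 * real n powr \<eta>)) \<le> real n powr (- (1 + p + \<theta>))) sequentially"
    using c_pos \<eta> by real_asymp
  have ev: "eventually (\<lambda>n::nat. (2 * real n) powr p * prob (A n) \<le> B * real n powr (- \<theta>)) sequentially"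
    using eventually_compose_filterlim[OF ev_y lim_n] ev_exp eventually_gt_at_top[of 0]
  proof eventually_elim
    case (elim n)
    define y where "y = real n powr \<delta>"
    have n: "0 < real n" using elim by simp
    have ya: "y powr (- \<alpha>) * real n = real n powr \<eta>"
      using n by (simp add: y_def powr_powr \<eta>_def powr_diff powr_minus divide_inverse)
    have yb: "real n * y powr (- \<beta>) = real n powr (- (p + \<theta>))"
      using n by (simp add: y_def powr_powr \<theta>_def powr_diff powr_minus divide_inverse powr_add)
    have nn: "real n * real n powr (- (1 + p + \<theta>)) = real n powr (- (p + \<theta>))"
      using n by (simp add: powr_diff powr_minus divide_inverse powr_add)
    have "prob (A n) \<le> 2 * real n * K * y powr (- \<beta>)
         + real n * exp \<bar>x\<bar> * exp (- (c / 8 * y powr (- \<alpha>) * real n))"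
      using emeasure_low_in_block_le[of y n x] elim K_nonneg
      by (subst ennreal_le_iff[symmetric]) (auto simp: A_def y_def emeasure_eq_measure)
    also have "\<dots> = 2 * K * (real n * y powr (- \<beta>))
         + exp \<bar>x\<bar> * (real n * exp (- (c / 8 * (y powr (- \<alpha>) * real n))))"
      by (simp add: mult_ac)
    also have "\<dots> \<le> 2 * K * real n powr (- (p + \<theta>))
         + exp \<bar>x\<bar> * (real n * real n powr (- (1 + p + \<theta>)))"
      unfolding ya yb using elim by (intro add_left_mono mult_left_mono) auto
    also have "\<dots> = (2 * K + exp \<bar>x\<bar>) * real n powr (- (p + \<theta>))"
      unfolding nn by (simp add: algebra_simps)
    finally have "(2 * real n) powr p * prob (A n)
        \<le> (2 * real n) powr p * ((2 * K + exp \<bar>x\<bar>) * real n powr (- (p + \<theta>)))"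
      by (intro mult_left_mono) auto
    also have "\<dots> = B * (real n powr p * real n powr (- (p + \<theta>)))"
      by (simp add: B_def powr_mult)
    also have "\<dots> = B * real n powr (- \<theta>)" by (simp add: powr_add[symmetric])
    finally show ?case .
  qed
  have lim_pow: "filterlim (\<lambda>k. 2 ^ k :: nat) at_top sequentially"
    by (rule filterlim_subseq) (simp add: strict_mono_def)
  have geo: "real (2 ^ k) powr (- \<theta>) = (2 powr (- \<theta>)) ^ k" for k
    by (simp add: powr_power powr_realpow[symmetric] powr_powr mult_ac)
  show ?thesis
  proof (rule summable_comparison_test_ev)
    show "\<forall>\<^sub>F k in sequentially. norm ((2 * 2 ^ k) powr p
           * prob {\<omega> \<in> space M. \<exists>t\<in>{2 ^ k..<2 * 2 ^ k}. X t \<omega> \<le> x}) \<le> B * (2 powr (- \<theta>)) ^ k"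
      using eventually_compose_filterlim[OF ev lim_pow]
      by eventually_elim (simp add: A_def geo[symmetric])
    show "summable (\<lambda>k. B * (2 powr (- \<theta>)) ^ k)"
      using \<theta> by (intro summable_mult summable_geometric) (auto simp: powr_minus field_simps)
  qed
qed

end

lemma le_suminf_ennreal:
  fixes f :: "nat \<Rightarrow> ennreal"
  shows "f k \<le> (\<Sum>k. f k)"
  using sum_le_suminf[of f "{k}"] by simp

lemma ennreal_one_le_imp_suminf_top:
  fixes f :: "nat \<Rightarrow> ennreal"
  assumes "infinite {k. 1 \<le> f k}"
  shows "(\<Sum>k. f k) = \<top>"
proof -
  have "of_nat n \<le> (\<Sum>k. f k)" for n
  proof -
    obtain S where S: "S \<subseteq> {k. 1 \<le> f k}" "finite S" "card S = n"
      using infinite_arbitrarily_large[OF assms] by blast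
    have "of_nat n = (\<Sum>k\<in>S. (1::ennreal))" using S by simp
    also have "\<dots> \<le> (\<Sum>k\<in>S. f k)" using S by (intro sum_mono) auto
    also have "\<dots> \<le> (\<Sum>k. f k)" using S by (intro sum_le_suminf) auto
    finally show ?thesis .
  qed
  then show ?thesis
    by (metis ennreal_Ex_less_of_nat not_less top.not_eq_extremum)
qed

lemma dyadic_block:
  assumes "0 < (t::nat)"
  obtains k where "t \<in> {2 ^ k..<2 * 2 ^ k}"
  using ex_power_ivl1[of 2 t] assms by auto

text \<open>
  A finite positive last exit time lies in some dyadic block, where it is itself a time at which
  the process is low, and the weight of that block is at least its \<open>p\<close>-th power.  If the process is
  low infinitely often, infinitely many blocks are hit, each with weight at least 1, and the sum is
  infinite, so that its finite mean also excludes this case almost surely when \<open>p > 0\<close>.  The summand 1 accounts for the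
  last exit time 0, which lies in no block, and for \<open>p = 0\<close>.
\<close>

lemma last_exit_powr_le:
  assumes p: "0 \<le> p"
  shows "enat_powr (last_exit X x \<omega>) p
    \<le> 1 + (\<Sum>k. ennreal ((2 * 2 ^ k) powr p) * of_bool (\<exists>t\<in>{2 ^ k..<2 * 2 ^ k}. X t \<omega> \<le> x))"
    (is "_ \<le> 1 + (\<Sum>k. ?f k)")
proof -
  let ?T = "{t. X t \<omega> \<le> x}"
  have one: "1 \<le> (2 * 2 ^ k) powr p" for k :: nat
  proof -
    have "(1::real) \<le> 2 ^ k" by (rule one_le_power) simp
    then show ?thesis using p by (intro ge_one_powr_ge_zero) linarith+
  qed
  show ?thesis
  proof (cases "p = 0 \<or> ?T = {} \<or> last_exit X x \<omega> = 0")
    case True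
    then have le_1: "enat_powr (last_exit X x \<omega>) p \<le> 1"
    proof (elim disjE)
      assume "?T = {}"
      then have "last_exit X x \<omega> = 0" unfolding last_exit_def by simp
      then show "enat_powr (last_exit X x \<omega>) p \<le> 1"
        by (simp add: enat_powr_def zero_enat_def)
    qed (auto simp: enat_powr_def zero_enat_def)
    from le_1 show ?thesis by (rule order.trans) simp
  next
    case False
    show ?thesis
    proof (cases "finite ?T")
      case True
      define m where "m = Max ?T"
      have m: "X m \<omega> \<le> x" "last_exit X x \<omega> = enat m"
        using True False Max_in[of ?T] by (auto simp: m_def last_exit_def)
      then have "0 < m" using False by (auto simp: zero_enat_def)
      then obtain k where k: "m \<in> {2 ^ k..<2 * 2 ^ k}" by (rule dyadic_block)
      then have "real m \<le> 2 * 2 ^ k"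
        by (metis atLeastLessThan_iff less_imp_le numeral_power_le_of_nat_cancel_iff of_nat_le_iff of_nat_mult of_nat_numeral of_nat_power)
      then have "enat_powr (last_exit X x \<omega>) p \<le> ennreal ((2 * 2 ^ k) powr p)"
        using m p False by (auto simp: enat_powr_def intro!: ennreal_leI powr_mono2)
      also have "\<dots> = ?f k" using k m by auto
      also have "\<dots> \<le> (\<Sum>k. ?f k)"
        by (rule le_suminf_ennreal)
      also have "\<dots> \<le> 1 + (\<Sum>k. ?f k)" by simp
      finally show ?thesis .
    next
      case infinite: False
      have "infinite {k. 1 \<le> ?f k}"
      proof
        assume "finite {k. 1 \<le> ?f k}"
        then have "finite (insert 0 (\<Union>k\<in>{k. 1 \<le> ?f k}. {2 ^ k..<2 * 2 ^ k :: nat}))" by simp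
        moreover have "?T \<subseteq> insert 0 (\<Union>k\<in>{k. 1 \<le> ?f k}. {2 ^ k..<2 * 2 ^ k})"
        proof
          fix t assume t: "t \<in> ?T"
          show "t \<in> insert 0 (\<Union>k\<in>{k. 1 \<le> ?f k}. {2 ^ k..<2 * 2 ^ k})"
          proof (cases "t = 0")
            case False
            then obtain k where k: "t \<in> {2 ^ k..<2 * 2 ^ k}" using dyadic_block by blast
            then have "\<exists>t\<in>{2 ^ k..<2 * 2 ^ k}. X t \<omega> \<le> x" using t by blast
            then have "1 \<le> ?f k" using one[of k] by simp
            then show ?thesis using k by blast
          qed simp
        qed
        ultimately show False using infinite finite_subset by blast
      qed
      then have "(\<Sum>k. ?f k) = \<top>" by (rule ennreal_one_le_imp_suminf_top)
      then show ?thesis by simp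
    qed
  qed
qed

theorem theorem2p6:
  fixes M :: "'a measure" and F :: "nat \<Rightarrow> 'a measure" and X :: "nat \<Rightarrow> 'a \<Rightarrow> real"
    and \<alpha> \<beta> c x0 x p :: real and C :: ennreal
  assumes "prob_space M"
    and "filtration (space M) F"
    and "\<And>t. subalgebra M (F t)"
    and "\<And>t. X t \<in> borel_measurable (F t)"
    and "\<And>\<omega>. \<omega> \<in> space M \<Longrightarrow> X 0 \<omega> = 0"
    and "0 < \<alpha>" and "\<alpha> < 1" and "\<alpha> < \<beta>"
    and "0 < c" and "C < \<infinity>" and "0 < x0"
    and "\<And>t. AE \<omega> in M.
           nn_cond_exp M (F t) (\<lambda>\<omega>. ennreal (neg_part (increment X t \<omega>) powr \<beta>)) \<omega> \<le> C"
    and "\<And>y t. x0 \<le> y \<Longrightarrow> AE \<omega> in M.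
           ennreal (c * y powr (1 - \<alpha>))
             \<le> nn_cond_exp M (F t)
                  (\<lambda>\<omega>. ennreal (pos_part (increment X t \<omega>)
                                 * indicator {..y} (pos_part (increment X t \<omega>)))) \<omega>"
    and "0 \<le> p" and "p < \<beta> / \<alpha> - 1"
  shows "(\<integral>\<^sup>+ \<omega>. enat_powr (last_exit X x \<omega>) p \<partial>M) < \<infinity>"
proof -
  obtain K where K: "C = ennreal K" "0 \<le> K" using \<open>C < \<infinity>\<close> by (cases C) auto
  interpret prob_space M by fact
  interpret filtration "space M" F by fact
  interpret strong_positive_drift M F X \<alpha> \<beta> c x0 K
    using assms K by unfold_locales auto
  let ?A = "\<lambda>k::nat. {\<omega> \<in> space M. \<exists>t\<in>{2 ^ k..<2 * 2 ^ k}. X t \<omega> \<le> x}"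
  let ?b = "\<lambda>k::nat. (2 * 2 ^ k) powr p :: real"
  have "(\<integral>\<^sup>+ \<omega>. enat_powr (last_exit X x \<omega>) p \<partial>M)
      \<le> (\<integral>\<^sup>+ \<omega>. 1 + (\<Sum>k. ennreal (?b k) * indicator (?A k) \<omega>) \<partial>M)"
  proof (rule nn_integral_mono)
    fix \<omega> assume "\<omega> \<in> space M"
    then have "of_bool (\<exists>t\<in>{2 ^ k..<2 * 2 ^ k}. X t \<omega> \<le> x) = (indicator (?A k) \<omega> :: ennreal)" for k
      by (simp add: indicator_def)
    then show "enat_powr (last_exit X x \<omega>) p \<le> 1 + (\<Sum>k. ennreal (?b k) * indicator (?A k) \<omega>)"
      using last_exit_powr_le[OF \<open>0 \<le> p\<close>, of X x \<omega>] by simp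
  qed
  also have "\<dots> = 1 + (\<Sum>k. ennreal (?b k) * emeasure M (?A k))"
    by (simp add: nn_integral_add nn_integral_suminf nn_integral_cmult_indicator emeasure_space_1)
  also have "\<dots> = 1 + (\<Sum>k. ennreal (?b k * prob (?A k)))"
    by (simp add: emeasure_eq_measure ennreal_mult)
  also have "\<dots> = 1 + ennreal (\<Sum>k. ?b k * prob (?A k))"
    using summable_dyadic_blocks[OF \<open>0 \<le> p\<close> \<open>p < \<beta> / \<alpha> - 1\<close>, of x]
    by (subst suminf_ennreal2) auto
  also have "\<dots> < \<infinity>" by simp
  finally show ?thesis .
qed

end
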